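(* Let $q\ge2$, let $p\in\Delta_q$ be a set of fixed reference probabilities with $p_i>0$ for all $i$, let $\theta\in[0,1]$, and let $$\gamma=\frac{1}{\max_{i=1,\dots,q}\sum_{j=1,\,j\ne i}^q p_j}>1 .$$ Let $x^0\in\mathrm{Range}(\mathbf{B}^{-1}\mathbf{A}^\top)$ and let $(x^k)_{k\ge0}$ be generated by capped adaptive sketch-and-project: for every $k\ge0$, set $$\mathcal{W}_k=\Bigl\{i\ :\ f_i(x^k)\ge\theta\max_{j=1,\dots,q}f_j(x^k)+(1-\theta)\,\mathbb{E}_{j\sim p}[f_j(x^k)]\Bigr\},$$ choose any $p^k\in\Delta_q$ whose support is contained in $\mathcal{W}_k$, draw $i_k$ with $\mathbb{P}[i_k=i\mid x^k]=p_i^k$, and set $x^{k+1}=x^k-\mathbf{B}^{-1}\mathbf{A}^\top\mathbf{H}_{i_k}(\mathbf{A}x^k-b)$. Then for $k\ge1$ $$\mathbb{E}\bigl[\|x^{k}-x^*\|_{\mathbf{B}}^2\bigr]\le\Bigl(1-\bigl(\theta\gamma+(1-\theta)\bigr)\sigma_p^2(\mathbf{B},\mathbf{S})\Bigr)^{k-1}\Bigl(1-\theta\,\sigma_\infty^2(\mathbf{B},\mathbf{S})-(1-\theta)\,\sigma_p^2(\mathbf{B},\mathbf{S})\Bigr)\|x^{0}-x^*\|_{\mathbf{B}}^2,$$ where the expectation is taken with respect to the probabilities $p^k$ used by the algorithm.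
   Context: Setting: $\mathbf{A}\in\mathbb{R}^{m\times n}$ is a nonzero matrix and $b\in\mathbb{R}^m$ is such that $\mathbf{A}x=b$ is consistent. $\mathbf{B}\in\mathbb{R}^{n\times n}$ is symmetric positive definite. For positive semidefinite $\mathbf{G}$, $\|v\|_{\mathbf{G}}^2=\langle v,\mathbf{G}v\rangle$. $x^*$ is the solution of $\mathbf{A}x=b$ minimizing $\frac12\|x\|_{\mathbf{B}}^2$. $\mathbf{S}_1,\dots,\mathbf{S}_q\in\mathbb{R}^{m\times\tau}$ is a finite family of sketching matrices, collectively denoted $\mathbf{S}$. With $\dagger$ the Moore–Penrose pseudoinverse, $$\mathbf{H}_i=\mathbf{S}_i(\mathbf{S}_i^\top\mathbf{A}\mathbf{B}^{-1}\mathbf{A}^\top\mathbf{S}_i)^\dagger\mathbf{S}_i^\top,\qquad \mathbf{Z}_i=\mathbf{B}^{-1/2}\mathbf{A}^\top\mathbf{H}_i\mathbf{A}\mathbf{B}^{-1/2},\qquad f_i(x)=\|\mathbf{A}x-b\|_{\mathbf{H}_i}^2 .$$ $\Delta_q=\{p\in\mathbb{R}^q:\sum_i p_i=1,\ p_i\ge0\}$ and $\mathbb{E}_{i\sim p}[y_i]=\sum_{i=1}^q p_iy_i$ for any scalars or matrices $y_i$. The spectral constants are $$\sigma_\infty^2(\mathbf{B},\mathbf{S})=\min_{0\ne v\in\mathrm{Range}(\mathbf{B}^{-1}\mathbf{A}^\top)}\max_{i=1,\dots,q}\frac{\|\mathbf{B}^{1/2}v\|_{\mathbf{Z}_i}^2}{\|v\|_{\mathbf{B}}^2},\qquad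 \sigma_p^2(\mathbf{B},\mathbf{S})=\min_{0\ne v\in\mathrm{Range}(\mathbf{B}^{-1}\mathbf{A}^\top)}\frac{\|\mathbf{B}^{1/2}v\|_{\mathbb{E}_{i\sim p}[\mathbf{Z}_i]}^2}{\|v\|_{\mathbf{B}}^2}.$$ The vector $p^k$ is determined by $x^k$. The convention $0^0=1$ is used. *)

theory Defs
  imports "HOL-Analysis.Analysis" "HOL-Probability.Probability"
begin

definition psd_matrix :: "real^'n^'n \<Rightarrow> bool" where
  "psd_matrix G \<longleftrightarrow> transpose G = G \<and> (\<forall>x. 0 \<le> x \<bullet> (G *v x))"

definition spd_matrix :: "real^'n^'n \<Rightarrow> bool" where
  "spd_matrix G \<longleftrightarrow> transpose G = G \<and> (\<forall>x. x \<noteq> 0 \<longrightarrow> 0 < x \<bullet> (G *v x))"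

text \<open>The square root of a positive semidefinite matrix \<open>G\<close> exists and is unique; so does the
  Moore--Penrose pseudoinverse of any real matrix, characterised by the four Penrose equations.\<close>

definition matrix_sqrt :: "real^'n^'n \<Rightarrow> real^'n^'n" where
  "matrix_sqrt G = (THE R. psd_matrix R \<and> R ** R = G)"

definition mp_pinv :: "real^'n^'m \<Rightarrow> real^'m^'n" where
  "mp_pinv A = (THE X. A ** X ** A = A \<and> X ** A ** X = X \<and>
     transpose (A ** X) = A ** X \<and> transpose (X ** A) = X ** A)"

text \<open>The squared weighted norm \<open>\<parallel>v\<parallel>\<^sub>G\<^sup>2 = \<langle>v, G v\<rangle>\<close>.\<close>

definition wnorm2 :: "real^'n^'n \<Rightarrow> real^'n \<Rightarrow> real" where
  "wnorm2 G v = v \<bullet> (G *v v)"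

definition min_norm_solution :: "real^'n^'m \<Rightarrow> real^'m \<Rightarrow> real^'n^'n \<Rightarrow> real^'n" where
  "min_norm_solution A b B = arg_min (\<lambda>x. 1 / 2 * wnorm2 B x) (\<lambda>x. A *v x = b)"

definition sketch_H :: "real^'n^'m \<Rightarrow> real^'n^'n \<Rightarrow> real^'t^'m \<Rightarrow> real^'m^'m" where
  "sketch_H A B T =
     T ** mp_pinv (transpose T ** A ** matrix_inv B ** transpose A ** T) ** transpose T"

definition sketch_Z :: "real^'n^'m \<Rightarrow> real^'n^'n \<Rightarrow> real^'t^'m \<Rightarrow> real^'n^'n" where
  "sketch_Z A B T =
     matrix_inv (matrix_sqrt B) ** transpose A ** sketch_H A B T ** A ** matrix_inv (matrix_sqrt B)"

definition sketched_loss ::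
  "real^'n^'m \<Rightarrow> real^'m \<Rightarrow> real^'n^'n \<Rightarrow> real^'t^'m \<Rightarrow> real^'n \<Rightarrow> real" where
  "sketched_loss A b B T x = wnorm2 (sketch_H A B T) (A *v x - b)"

definition sketch_step ::
  "real^'n^'m \<Rightarrow> real^'m \<Rightarrow> real^'n^'n \<Rightarrow> real^'t^'m \<Rightarrow> real^'n \<Rightarrow> real^'n" where
  "sketch_step A b B T x =
     x - (matrix_inv B ** transpose A ** sketch_H A B T) *v (A *v x - b)"

definition prob_simplex :: "(real^'q) set" where
  "prob_simplex = {p. (\<Sum>i\<in>UNIV. p $ i) = 1 \<and> (\<forall>i. 0 \<le> p $ i)}"

definition pmean :: "real^'q \<Rightarrow> ('q \<Rightarrow> 'a::real_vector) \<Rightarrow> 'a" where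
  "pmean p y = (\<Sum>i\<in>UNIV. p $ i *\<^sub>R y i)"

definition sketch_range :: "real^'n^'m \<Rightarrow> real^'n^'n \<Rightarrow> (real^'n) set" where
  "sketch_range A B = range (\<lambda>y. (matrix_inv B ** transpose A) *v y)"

text \<open>The minima in the spectral constants are over infinite sets and are written as infima;
  the lemmas \<open>sigma_inf_sq_attained\<close> and \<open>sigma_p_sq_attained\<close> below show that they are attained.\<close>

definition sigma_inf_sq ::
  "real^'n^'m \<Rightarrow> real^'n^'n \<Rightarrow> ('q::finite \<Rightarrow> real^'t^'m) \<Rightarrow> real" where
  "sigma_inf_sq A B S =
     (INF v \<in> sketch_range A B - {0}.
        MAX i \<in> UNIV. wnorm2 (sketch_Z A B (S i)) (matrix_sqrt B *v v) / wnorm2 B v)"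

definition sigma_p_sq ::
  "real^'n^'m \<Rightarrow> real^'n^'n \<Rightarrow> ('q::finite \<Rightarrow> real^'t^'m) \<Rightarrow> real^'q \<Rightarrow> real" where
  "sigma_p_sq A B S p =
     (INF v \<in> sketch_range A B - {0}.
        wnorm2 (pmean p (\<lambda>i. sketch_Z A B (S i))) (matrix_sqrt B *v v) / wnorm2 B v)"

definition capped_gamma :: "real^'q \<Rightarrow> real" where
  "capped_gamma p = 1 / (MAX i \<in> UNIV. \<Sum>j\<in>UNIV - {i}. p $ j)"

definition capped_set ::
  "real^'n^'m \<Rightarrow> real^'m \<Rightarrow> real^'n^'n \<Rightarrow> ('q::finite \<Rightarrow> real^'t^'m) \<Rightarrow> real^'q \<Rightarrow> real \<Rightarrow>
   real^'n \<Rightarrow> 'q set" where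
  "capped_set A b B S p \<theta> x =
     {i. sketched_loss A b B (S i) x \<ge>
           \<theta> * (MAX j \<in> UNIV. sketched_loss A b B (S j) x)
           + (1 - \<theta>) * pmean p (\<lambda>j. sketched_loss A b B (S j) x)}"

lemma wnorm2_scaleR: "wnorm2 G (c *\<^sub>R v) = c\<^sup>2 * wnorm2 G v"
  by (simp add: wnorm2_def matrix_vector_mult_scaleR power2_eq_square)

lemma continuous_on_wnorm2 [continuous_intros]:
  assumes "continuous_on U f"
  shows "continuous_on U (\<lambda>v. wnorm2 G (f v))"
  unfolding wnorm2_def
  using assms by (intro continuous_on_inner matrix_vector_mult_linear_continuous_on[THEN continuous_on_compose2]) auto

lemma continuous_on_Max_finite:
  fixes f :: "'i \<Rightarrow> 'a::topological_space \<Rightarrow> real"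
  assumes "finite J" "J \<noteq> {}" "\<And>i. i \<in> J \<Longrightarrow> continuous_on U (f i)"
  shows "continuous_on U (\<lambda>v. MAX i \<in> J. f i v)"
  using assms
proof (induction J rule: finite_ne_induct)
  case (insert i J)
  then have "continuous_on U (\<lambda>v. max (f i v) (MAX i \<in> J. f i v))"
    by (intro continuous_on_max) auto
  with insert.hyps show ?case by simp
qed simp

text \<open>A degree-zero homogeneous function that is continuous on the unit sphere of a nonzero
  subspace attains its infimum over the nonzero vectors of the subspace.\<close>

lemma homogeneous_attains_Inf:
  fixes V :: "'a::euclidean_space set" and r :: "'a \<Rightarrow> real"
  assumes V: "subspace V" "V - {0} \<noteq> {}"
    and cont: "continuous_on (V \<inter> sphere 0 1) r"
    and hom: "\<And>c v. c \<noteq> 0 \<Longrightarrow> r (c *\<^sub>R v) = r v"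
  shows "\<exists>v \<in> V - {0}. r v = (INF w \<in> V - {0}. r w) \<and> (\<forall>w \<in> V - {0}. r v \<le> r w)"
proof -
  have norml: "(1 / norm w) *\<^sub>R w \<in> V \<inter> sphere 0 1" if "w \<in> V - {0}" for w
    using that V(1) by (auto simp: subspace_scale)
  have "compact (V \<inter> sphere 0 1)"
    using closed_subspace[OF V(1)] by (simp add: closed_Int_compact)
  moreover have "V \<inter> sphere 0 1 \<noteq> {}" using V(2) norml by fastforce
  ultimately obtain v where v: "v \<in> V \<inter> sphere 0 1" "\<forall>w \<in> V \<inter> sphere 0 1. r v \<le> r w"
    using continuous_attains_inf[OF _ _ cont] by blast
  have v0: "v \<in> V - {0}" using v(1) by auto
  have le: "r v \<le> r w" if "w \<in> V - {0}" for w
  proof -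
    have "r v \<le> r ((1 / norm w) *\<^sub>R w)" using v(2) norml[OF that] by blast
    also have "\<dots> = r w" using that by (intro hom) auto
    finally show ?thesis .
  qed
  have "(INF w \<in> V - {0}. r w) = r v"
    using v0 le by (intro cInf_eq_minimum) auto
  with v0 le show ?thesis by auto
qed

lemma invertible_spd_matrix:
  fixes B :: "real^'n^'n"
  assumes "spd_matrix B" shows "invertible B"
proof -
  have "x = 0" if "B *v x = 0" for x
    using assms that unfolding spd_matrix_def by (metis inner_zero_right less_irrefl)
  then show ?thesis
    by (simp add: invertible_left_inverse matrix_left_invertible_ker)
qed

lemma sketch_range_nontrivial:
  fixes A :: "real^'n^'m"
  assumes "A \<noteq> 0" "spd_matrix B"
  shows "subspace (sketch_range A B)" "sketch_range A B - {0} \<noteq> {}"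
proof -
  show "subspace (sketch_range A B)"
    unfolding sketch_range_def by (intro linear_subspace_image) auto
  have "\<exists>C. B ** C = mat 1 \<and> C ** B = mat 1"
    using invertible_spd_matrix[OF assms(2)] unfolding invertible_def .
  then have "B ** matrix_inv B = mat 1"
    unfolding matrix_inv_def by (rule someI2_ex) blast
  then have "B ** (matrix_inv B ** transpose A) = transpose A"
    by (simp add: matrix_mul_assoc)
  moreover have "B ** (0 :: real^'m^'n) = 0"
    by (simp add: matrix_matrix_mult_def vec_eq_iff)
  moreover have "transpose A \<noteq> 0"
    using assms(1) by (auto simp: transpose_def vec_eq_iff)
  ultimately have "matrix_inv B ** transpose A \<noteq> 0"
    by metis
  then obtain y where "(matrix_inv B ** transpose A) *v y \<noteq> 0"
    by (metis matrix_eq matrix_vector_mult_0)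
  then show "sketch_range A B - {0} \<noteq> {}"
    unfolding sketch_range_def by auto
qed

lemma wnorm2_spd_unit:
  assumes "spd_matrix B" "norm v = 1" shows "wnorm2 B v \<noteq> 0"
proof -
  have "v \<noteq> 0" using assms(2) by auto
  then show ?thesis
    using assms(1) unfolding spd_matrix_def wnorm2_def by (metis less_irrefl)
qed

lemma sigma_inf_sq_attained:
  fixes A :: "real^'n^'m" and S :: "'q::finite \<Rightarrow> real^'t^'m"
  assumes "A \<noteq> 0" "spd_matrix B"
  defines "r \<equiv> \<lambda>v. MAX i \<in> UNIV. wnorm2 (sketch_Z A B (S i)) (matrix_sqrt B *v v) / wnorm2 B v"
  shows "\<exists>v \<in> sketch_range A B - {0}. r v = sigma_inf_sq A B S \<and>
           (\<forall>w \<in> sketch_range A B - {0}. r v \<le> r w)"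
  unfolding sigma_inf_sq_def r_def
  using wnorm2_spd_unit[OF assms(2)]
  by (intro homogeneous_attains_Inf sketch_range_nontrivial[OF assms(1,2)]
        continuous_on_Max_finite continuous_intros linear_continuous_on)
     (auto simp: matrix_vector_mult_scaleR wnorm2_scaleR)

lemma sigma_p_sq_attained:
  fixes A :: "real^'n^'m" and S :: "'q::finite \<Rightarrow> real^'t^'m" and p :: "real^'q"
  assumes "A \<noteq> 0" "spd_matrix B"
  defines "r \<equiv> \<lambda>v. wnorm2 (pmean p (\<lambda>i. sketch_Z A B (S i))) (matrix_sqrt B *v v) / wnorm2 B v"
  shows "\<exists>v \<in> sketch_range A B - {0}. r v = sigma_p_sq A B S p \<and>
           (\<forall>w \<in> sketch_range A B - {0}. r v \<le> r w)"
  unfolding sigma_p_sq_def r_def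
  using wnorm2_spd_unit[OF assms(2)]
  by (intro homogeneous_attains_Inf sketch_range_nontrivial[OF assms(1,2)]
        continuous_intros linear_continuous_on)
     (auto simp: matrix_vector_mult_scaleR wnorm2_scaleR)

end

theory Submission
  imports Defs
begin

text \<open>Let \<open>u = B^(1/2) (x - x\<^sup>*)\<close> be the error in Euclidean coordinates. Each matrix \<open>Z\<^sub>i\<close> is an
  orthogonal projector, a step with index \<open>i\<close> replaces \<open>u\<close> by \<open>u - Z\<^sub>i u\<close>, and the sketched loss
  \<open>f\<^sub>i(x)\<close> is \<open>u \<bullet> Z\<^sub>i u\<close>. Hence a step lowers the squared error by exactly the loss of the drawn
  sketch (\<open>wnorm2_sketch_step\<close>) and leaves an iterate at which that loss is zero
  (\<open>sketched_loss_sketch_step\<close>).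

  The capped rule only draws indices whose loss is at least
  \<open>\<theta> max\<^sub>j f\<^sub>j + (1 - \<theta>) E\<^sub>p f\<^sub>j\<close>, so the expected decrease is at least that (\<open>capped_mean_ge\<close>). The start
  and the solution \<open>x\<^sup>*\<close> lie in the range of \<open>B\<^sup>-\<^sup>1 A\<^sup>T\<close> (\<open>min_norm_solution\<close>), which the steps preserve;
  there the maximal loss is at least \<open>\<sigma>\<^sub>\<infinity>\<^sup>2\<close> and the mean loss at least \<open>\<sigma>\<^sub>p\<^sup>2\<close> times the squared error.
  This gives the factor of the first step. At every later iterate some loss is zero, which
  improves the bound for the maximal loss to \<open>\<gamma> \<sigma>\<^sub>p\<^sup>2\<close> times the squared error
  (\<open>gamma_mean_loss_le_Max_loss\<close>) and gives the factor of the later steps.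

  Multiplying the one-step bounds needs a nonnegative later factor. It can be negative only
  when every \<open>Z\<^sub>i\<close> is the identity on the relevant subspace
  (\<open>gamma_sigma_p_le_1_or_sigmas_eq_1\<close>); then both spectral constants are 1, the first factor is 0 and
  the method stops at \<open>x\<^sup>*\<close> after one step.

  That the \<open>Z\<^sub>i\<close> are projectors rests on the existence of the square root of \<open>B\<close> and on the
  symmetry of the pseudoinverse of a symmetric matrix. Both come from the spectral theorem, in
  the form of a functional calculus (\<open>symmetric_functional_calculus\<close>).\<close>

section \<open>The spectral theorem for symmetric matrices\<close>

text \<open>A maximiser of the Rayleigh quotient \<open>v \<bullet> f v\<close> on the unit sphere of \<open>V\<close> is an eigenvector: moving it
  along its residual \<open>g = f v - (v \<bullet> f v) v\<close>, which lies in \<open>V\<close>, would otherwise increase the quotient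
  to first order.\<close>

lemma self_adjoint_eigenvector:
  fixes f :: "'a::euclidean_space \<Rightarrow> 'a"
  assumes f: "linear f" and adj: "\<And>x y. f x \<bullet> y = x \<bullet> f y"
    and V: "subspace V" "V \<noteq> {0}" and inv: "f ` V \<subseteq> V"
  obtains v c where "v \<in> V" "norm v = 1" "f v = c *\<^sub>R v"
proof -
  define r where "r v = v \<bullet> f v" for v
  obtain u where u: "u \<in> V" "u \<noteq> 0"
    using V subspace_0[OF V(1)] by blast
  have cpt: "compact (V \<inter> sphere 0 1)"
    using closed_subspace[OF V(1)] by (simp add: closed_Int_compact)
  have "(1 / norm u) *\<^sub>R u \<in> V \<inter> sphere 0 1"
    using u V(1) by (auto simp: subspace_scale)
  then have ne: "V \<inter> sphere 0 1 \<noteq> {}"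
    by blast
  have cont: "continuous_on (V \<inter> sphere 0 1) r"
    unfolding r_def using f by (intro continuous_intros linear_continuous_on) (simp add: linear_conv_bounded_linear)
  obtain v where v: "v \<in> V" "norm v = 1" and max: "\<And>w. w \<in> V \<Longrightarrow> norm w = 1 \<Longrightarrow> r w \<le> r v"
    using continuous_attains_sup[OF cpt ne cont] by auto
  have scale: "r (a *\<^sub>R w) = a\<^sup>2 * r w" for a w
    by (simp add: r_def linear_scale[OF f] power2_eq_square)
  have bound: "r w \<le> r v * (w \<bullet> w)" if "w \<in> V" for w
  proof (cases "w = 0")
    case False
    have "r ((1 / norm w) *\<^sub>R w) \<le> r v"
      using that V(1) False by (intro max) (auto simp: subspace_scale)
    then have "r w / (norm w)\<^sup>2 \<le> r v"
      by (simp add: scale power_divide)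
    then show ?thesis
      using False by (simp add: divide_le_eq power2_norm_eq_inner)
  qed (simp add: r_def)
  define g where "g = f v - r v *\<^sub>R v"
  have g: "g \<in> V"
    unfolding g_def using inv v(1) V(1) by (intro subspace_diff subspace_scale) auto
  \<comment> \<open>The maximality of \<open>v\<close>, tested at \<open>v + t g\<close>: the left side is linear in \<open>t\<close>, the right side quadratic.\<close>
  have quad: "2 * t * (g \<bullet> g) \<le> t\<^sup>2 * (r v * (g \<bullet> g) - r g)" for t
  proof -
    have "r (v + t *\<^sub>R g) \<le> r v * ((v + t *\<^sub>R g) \<bullet> (v + t *\<^sub>R g))"
      using v(1) g V(1) by (intro bound subspace_add subspace_scale)
    moreover have "r (v + t *\<^sub>R g) = r v + 2 * t * (g \<bullet> f v) + t\<^sup>2 * r g"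
      using adj[of v g] unfolding r_def
      by (simp add: linear_add[OF f] linear_scale[OF f] inner_left_distrib inner_right_distrib
          power2_eq_square inner_commute algebra_simps)
    moreover have "(v + t *\<^sub>R g) \<bullet> (v + t *\<^sub>R g) = 1 + 2 * t * (g \<bullet> v) + t\<^sup>2 * (g \<bullet> g)"
      using v(2) by (simp add: inner_left_distrib inner_right_distrib inner_commute
          power2_eq_square algebra_simps norm_eq_1)
    ultimately have "r v + 2 * t * (g \<bullet> f v) + t\<^sup>2 * r g
        \<le> r v * (1 + 2 * t * (g \<bullet> v) + t\<^sup>2 * (g \<bullet> g))"
      by simp
    then have "2 * t * (g \<bullet> f v - r v * (g \<bullet> v)) \<le> t\<^sup>2 * (r v * (g \<bullet> g) - r g)"
      by argo
    moreover have "g \<bullet> f v - r v * (g \<bullet> v) = g \<bullet> g"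
      by (simp add: g_def inner_diff_right)
    ultimately show ?thesis
      by simp
  qed
  have "g = 0"
  proof (rule ccontr)
    assume "g \<noteq> 0"
    then have gg: "g \<bullet> g > 0" by simp
    \<comment> \<open>The inequality fails for small \<open>t > 0\<close>; the summand 1 only keeps \<open>K\<close> positive.\<close>
    define K where "K = \<bar>r v * (g \<bullet> g) - r g\<bar> + 1"
    define t where "t = g \<bullet> g / K"
    have K: "K > 0" unfolding K_def by linarith
    have t: "t > 0" using gg K by (simp add: t_def)
    have "2 * t * (g \<bullet> g) \<le> t\<^sup>2 * K"
      using quad[of t] by (rule order_trans) (simp add: K_def mult_left_mono)
    also have "\<dots> = t * (g \<bullet> g)"
      using K by (simp add: t_def power2_eq_square)
    finally show False using t gg by simp
  qed
  then show ?thesis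
    using that[OF v, of "r v"] by (simp add: g_def)
qed

text \<open>The orthogonal complement in \<open>V\<close> of an eigenvector is again invariant under \<open>f\<close>, so eigenvectors can
  be split off one dimension at a time.\<close>

lemma self_adjoint_orthonormal_eigenbasis:
  fixes f :: "'a::euclidean_space \<Rightarrow> 'a"
  assumes f: "linear f" and adj: "\<And>x y. f x \<bullet> y = x \<bullet> f y"
    and "subspace V" "f ` V \<subseteq> V"
  shows "\<exists>E. pairwise orthogonal E \<and> span E = V \<and> (\<forall>v\<in>E. norm v = 1 \<and> (\<exists>c. f v = c *\<^sub>R v))"
  using assms(3,4)
proof (induction "dim V" arbitrary: V rule: less_induct)
  case (less V)
  show ?case
  proof (cases "V = {0}")
    case True
    then show ?thesis by (intro exI[of _ "{}"]) simp
  next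
    case False
    then obtain v c where v: "v \<in> V" "norm v = 1" "f v = c *\<^sub>R v"
      using self_adjoint_eigenvector[OF f adj less.prems(1) _ less.prems(2)] by metis
    define W where "W = {w \<in> V. orthogonal v w}"
    have W: "subspace W"
      unfolding W_def using less.prems(1) subspace_orthogonal_to_vector[of v]
      by (auto simp: subspace_def orthogonal_def inner_right_distrib)
    have "f ` W \<subseteq> W"
    proof -
      have "v \<bullet> f w = 0" if "v \<bullet> w = 0" for w
        using adj[of v w] v(3) that by simp
      then show ?thesis
        using less.prems(2) by (auto simp: W_def orthogonal_def)
    qed
    moreover have "dim W < dim V"
    proof (rule dim_psubset)
      have "v \<notin> W" using v(2) by (auto simp: W_def orthogonal_def)
      then show "span W \<subset> span V"
        using W less.prems(1) v(1) span_eq_iff W_def by (metis (no_types, lifting) mem_Collect_eq psubsetI subsetI)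
    qed
    ultimately obtain E where E: "pairwise orthogonal E" "span E = W"
      "\<forall>v\<in>E. norm v = 1 \<and> (\<exists>c. f v = c *\<^sub>R v)"
      using less.hyps[OF _ W] by blast
    have "pairwise orthogonal (insert v E)"
      using E(1,2) span_base[of _ E] unfolding W_def
      by (force simp: pairwise_insert orthogonal_commute)
    moreover have "span (insert v E) = V"
    proof
      have "insert v E \<subseteq> V"
        using v(1) E(2) span_base[of _ E] unfolding W_def by blast
      then show "span (insert v E) \<subseteq> V"
        using less.prems(1) by (rule span_minimal)
      show "V \<subseteq> span (insert v E)"
      proof
        fix w assume w: "w \<in> V"
        have "w - (v \<bullet> w) *\<^sub>R v \<in> span E"
          unfolding E(2) W_def using w v(1,2) less.prems(1)
          by (auto simp: subspace_diff subspace_scale orthogonal_def inner_diff_right norm_eq_1)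
        then show "w \<in> span (insert v E)"
          by (metis span_breakdown_eq)
      qed
    qed
    ultimately show ?thesis
      using E(3) v by (intro exI[of _ "insert v E"]) auto
  qed
qed

lemma inner_matrix_vector_left: "(M *v x) \<bullet> y = x \<bullet> (transpose M *v y)" for M :: "real^'n^'m"
  using dot_lmul_matrix[of y M x] by (simp add: inner_commute)

lemma inner_symmetric_matrix:
  fixes M :: "real^'n^'n"
  assumes "transpose M = M" shows "(M *v x) \<bullet> y = x \<bullet> (M *v y)"
  using inner_matrix_vector_left[of M x y] assms by simp

text \<open>On a unit eigenvector the eigenvalue equals the Rayleigh quotient; writing it so makes the eigenvalue
  a function of the vector.\<close>

lemma symmetric_matrix_orthonormal_eigenbasis:
  fixes G :: "real^'n^'n"
  assumes "transpose G = G"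
  obtains E where "finite E" "pairwise orthogonal E" "span E = UNIV"
    "\<And>v. v \<in> E \<Longrightarrow> norm v = 1" "\<And>v. v \<in> E \<Longrightarrow> G *v v = (v \<bullet> (G *v v)) *\<^sub>R v"
proof -
  obtain E where E: "pairwise orthogonal E" "span E = UNIV"
      "\<forall>v\<in>E. norm v = 1 \<and> (\<exists>c. G *v v = c *\<^sub>R v)"
    using self_adjoint_orthonormal_eigenbasis[of "(*v) G" UNIV] inner_symmetric_matrix[OF assms]
    by auto
  show ?thesis
  proof (rule that[OF pairwise_orthogonal_imp_finite[OF E(1)] E(1,2)])
    show "norm v = 1" if "v \<in> E" for v using E(3) that by blast
    show "G *v v = (v \<bullet> (G *v v)) *\<^sub>R v" if "v \<in> E" for v
      using E(3) that by (metis inner_scaleR_right mult.right_neutral norm_eq_1)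
  qed
qed

lemma matrix_eq_on_spanning_set:
  fixes M N :: "real^'n^'m"
  assumes "span E = UNIV" "\<And>v. v \<in> E \<Longrightarrow> M *v v = N *v v"
  shows "M = N"
  using linear_eq_on_span[of "(*v) M" "(*v) N" E] assms by (auto simp: matrix_eq)

text \<open>The map \<open>F\<close> applies a real function to the eigenvalues of \<open>G\<close>, as
  \<open>F \<phi> = (\<Sum>v\<in>E. \<phi> (\<lambda>\<^sub>v) v v\<^sup>T)\<close> for an orthonormal eigenbasis \<open>E\<close>. Identities between matrices built
  from \<open>G\<close> thereby reduce to identities between real numbers; the last property says that these need
  to hold only on the spectrum. The pseudoinverse of \<open>G\<close> is \<open>F inverse\<close>, and \<open>F sqrt\<close>
  is the square root of a positive semidefinite \<open>G\<close>.\<close>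

lemma symmetric_functional_calculus:
  fixes G :: "real^'n^'n"
  assumes "transpose G = G"
  obtains F :: "(real \<Rightarrow> real) \<Rightarrow> real^'n^'n"
    where "\<And>\<phi>. transpose (F \<phi>) = F \<phi>"
      and "\<And>\<phi> \<psi>. F \<phi> ** F \<psi> = F (\<lambda>t. \<phi> t * \<psi> t)"
      and "F (\<lambda>t. t) = G"
      and "\<And>\<phi> \<psi>. (\<And>t v. v \<noteq> 0 \<Longrightarrow> G *v v = t *\<^sub>R v \<Longrightarrow> \<phi> t = \<psi> t) \<Longrightarrow> F \<phi> = F \<psi>"
proof -
  obtain E where E: "finite E" "pairwise orthogonal E" "span E = UNIV"
      and unit: "\<And>v. v \<in> E \<Longrightarrow> norm v = 1"
      and eig: "\<And>v. v \<in> E \<Longrightarrow> G *v v = (v \<bullet> (G *v v)) *\<^sub>R v"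
    using symmetric_matrix_orthonormal_eigenbasis[OF assms] by blast
  define ev where "ev v = v \<bullet> (G *v v)" for v
  define F where "F \<phi> = (\<chi> i j. \<Sum>v\<in>E. \<phi> (ev v) * v $ i * v $ j)" for \<phi> :: "real \<Rightarrow> real"
  have F_vec: "F \<phi> *v y = (\<Sum>v\<in>E. (\<phi> (ev v) * (v \<bullet> y)) *\<^sub>R v)" for \<phi> y
    unfolding F_def vec_eq_iff matrix_vector_mult_def inner_vec_def
    by (auto simp: sum_distrib_right sum_distrib_left sum.swap[of _ E UNIV] mult_ac)
  have F_eig: "F \<phi> *v w = \<phi> (ev w) *\<^sub>R w" if "w \<in> E" for \<phi> w
  proof -
    have "v \<bullet> w = (if v = w then 1 else 0)" if "v \<in> E" for v
      using E(2) \<open>w \<in> E\<close> that unit[OF that] by (auto simp: pairwise_def orthogonal_def norm_eq_1)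
    then have "F \<phi> *v w = (\<Sum>v\<in>E. if v = w then \<phi> (ev w) *\<^sub>R w else 0)"
      unfolding F_vec by (intro sum.cong) auto
    then show ?thesis using E(1) that by simp
  qed
  show ?thesis
  proof (rule that)
    show "transpose (F \<phi>) = F \<phi>" for \<phi>
      by (simp add: F_def transpose_def vec_eq_iff mult_ac)
    show "F \<phi> ** F \<psi> = F (\<lambda>t. \<phi> t * \<psi> t)" for \<phi> \<psi>
      by (rule matrix_eq_on_spanning_set[OF E(3)])
        (simp add: F_eig matrix_vector_mul_assoc[symmetric] matrix_vector_mult_scaleR mult.commute)
    show "F (\<lambda>t. t) = G"
      by (rule matrix_eq_on_spanning_set[OF E(3)]) (metis F_eig eig ev_def)
    show "F \<phi> = F \<psi>" if eq: "\<And>t v. v \<noteq> 0 \<Longrightarrow> G *v v = t *\<^sub>R v \<Longrightarrow> \<phi> t = \<psi> t" for \<phi> \<psi>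
    proof (rule matrix_eq_on_spanning_set[OF E(3)])
      fix v assume v: "v \<in> E"
      then have "v \<noteq> 0" using unit by force
      then have "\<phi> (ev v) = \<psi> (ev v)" using eq eig[OF v] unfolding ev_def by blast
      then show "F \<phi> *v v = F \<psi> *v v" by (simp add: F_eig v)
    qed
  qed
qed

section \<open>Square roots and pseudoinverses of symmetric matrices\<close>

lemma psd_matrix_square:
  assumes "transpose R = R" shows "psd_matrix (R ** R)"
proof -
  have "x \<bullet> ((R ** R) *v x) = (R *v x) \<bullet> (R *v x)" for x
    by (simp only: inner_symmetric_matrix[OF assms] matrix_vector_mul_assoc)
  then show ?thesis
    by (simp add: psd_matrix_def matrix_transpose_mul assms)
qed

lemma psd_sqrt_exists:
  fixes G :: "real^'n^'n"
  assumes "psd_matrix G"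
  shows "\<exists>R. psd_matrix R \<and> R ** R = G"
proof -
  have symG: "transpose G = G" and pos: "\<And>x. 0 \<le> x \<bullet> (G *v x)"
    using assms by (auto simp: psd_matrix_def)
  obtain F :: "(real \<Rightarrow> real) \<Rightarrow> real^'n^'n" where F: "\<And>\<phi>. transpose (F \<phi>) = F \<phi>"
      "\<And>\<phi> \<psi>. F \<phi> ** F \<psi> = F (\<lambda>t. \<phi> t * \<psi> t)" "F (\<lambda>t. t) = G"
      "\<And>\<phi> \<psi>. (\<And>t v. v \<noteq> 0 \<Longrightarrow> G *v v = t *\<^sub>R v \<Longrightarrow> \<phi> t = \<psi> t) \<Longrightarrow> F \<phi> = F \<psi>"
    using symmetric_functional_calculus[OF symG] by blast
  have nonneg: "0 \<le> t" if "v \<noteq> 0" "G *v v = t *\<^sub>R v" for t v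
    proof -
    have "0 \<le> t * (v \<bullet> v)" using pos[of v] that(2) by simp
    moreover have "0 < v \<bullet> v" using that(1) by simp
    ultimately show ?thesis by (simp add: zero_le_mult_iff)
  qed
  have "F sqrt ** F sqrt = F (\<lambda>t. t)"
    unfolding F(2) by (rule F(4)) (use nonneg in auto)
  \<comment> \<open>A fourth root exhibits \<open>F sqrt\<close> as a square, hence as positive semidefinite.\<close>
  moreover have "F (\<lambda>t. sqrt (sqrt t)) ** F (\<lambda>t. sqrt (sqrt t)) = F sqrt"
    unfolding F(2) by (rule F(4)) (use nonneg in auto)
  ultimately show ?thesis
    using psd_matrix_square[OF F(1), of "\<lambda>t. sqrt (sqrt t)"] F(3) by auto
qed

text \<open>Both roots have the same eigenvectors: if \<open>R v = c v\<close>, then \<open>(Q + c) (Q - c) v = (Q\<^sup>2 - c\<^sup>2) v = 0\<close>,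
  and positive semidefiniteness of \<open>Q\<close> forces \<open>(Q - c) v = 0\<close>. When \<open>c = 0\<close>, where \<open>Q + c\<close> may be
  singular, the symmetry of \<open>Q\<close> gives it instead.\<close>

lemma psd_sqrt_unique:
  assumes R: "psd_matrix R" and Q: "psd_matrix Q" and eq: "R ** R = Q ** Q"
  shows "R = Q"
proof -
  have symR: "transpose R = R" and symQ: "transpose Q = Q"
    and posR: "\<And>x. 0 \<le> x \<bullet> (R *v x)" and posQ: "\<And>x. 0 \<le> x \<bullet> (Q *v x)"
    using R Q by (auto simp: psd_matrix_def)
  obtain E where "finite E" "pairwise orthogonal E" and E: "span E = UNIV"
      and unit: "\<And>v. v \<in> E \<Longrightarrow> norm v = 1"
      and eig: "\<And>v. v \<in> E \<Longrightarrow> R *v v = (v \<bullet> (R *v v)) *\<^sub>R v"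
    using symmetric_matrix_orthonormal_eigenbasis[OF symR] by blast
  show ?thesis
  proof (rule matrix_eq_on_spanning_set[OF E])
    fix v assume v: "v \<in> E"
    define c where "c = v \<bullet> (R *v v)"
    have c: "0 \<le> c" "R *v v = c *\<^sub>R v" using posR eig[OF v] by (auto simp: c_def)
    define d where "d = Q *v v - c *\<^sub>R v"
    have "Q *v (Q *v v) = R *v (R *v v)" by (simp add: eq matrix_vector_mul_assoc)
    also have "\<dots> = c *\<^sub>R (c *\<^sub>R v)" by (simp add: c(2) matrix_vector_mult_scaleR)
    finally have Qd: "Q *v d = - c *\<^sub>R d"
      by (simp add: d_def matrix_vector_mult_diff_distrib matrix_vector_mult_scaleR scaleR_diff_right)
    have "d = 0"
    proof (cases "c = 0")
      case True
      then have "Q *v (Q *v v) = 0" using Qd by (simp add: d_def)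
      then have "(Q *v v) \<bullet> (Q *v v) = 0" using inner_symmetric_matrix[OF symQ] by simp
      then show ?thesis using True by (simp add: d_def)
    next
      case False
      have "0 \<le> - c * (d \<bullet> d)" using posQ[of d] by (simp add: Qd)
      then have "c * (d \<bullet> d) \<le> 0" by simp
      then have "d \<bullet> d \<le> 0" using False c(1) by (simp add: mult_le_0_iff)
      then show ?thesis using inner_gt_zero_iff[of d] by linarith
    qed
    then show "R *v v = Q *v v" by (simp add: d_def c(2))
  qed
qed

lemma matrix_sqrt_psd:
  assumes "psd_matrix G"
  shows "psd_matrix (matrix_sqrt G)" "matrix_sqrt G ** matrix_sqrt G = G"
proof -
  have "\<exists>!R. psd_matrix R \<and> R ** R = G"
    using psd_sqrt_exists[OF assms] psd_sqrt_unique by metis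
  from theI'[OF this]
  show "psd_matrix (matrix_sqrt G)" "matrix_sqrt G ** matrix_sqrt G = G"
    unfolding matrix_sqrt_def by auto
qed

definition is_mp_pinv :: "real^'n^'m \<Rightarrow> real^'m^'n \<Rightarrow> bool" where
  "is_mp_pinv A X \<longleftrightarrow> A ** X ** A = A \<and> X ** A ** X = X \<and>
     transpose (A ** X) = A ** X \<and> transpose (X ** A) = X ** A"

text \<open>Penrose's argument: the four equations determine the two projectors \<open>A X\<close> and \<open>X A\<close>, and
  \<open>X = X A X\<close> is determined by them.\<close>

lemma is_mp_pinv_unique:
  assumes "is_mp_pinv A X" "is_mp_pinv A Y" shows "X = Y"
proof -
  note X = assms(1)[unfolded is_mp_pinv_def] and Y = assms(2)[unfolded is_mp_pinv_def]
  have "A ** X = transpose (A ** X)" using X by simp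
  also have "\<dots> = transpose ((A ** Y) ** (A ** X))" using Y by (simp add: matrix_mul_assoc)
  also have "\<dots> = (A ** X) ** (A ** Y)" using X Y by (simp only: matrix_transpose_mul)
  also have "\<dots> = A ** Y" using X by (simp add: matrix_mul_assoc)
  finally have l: "A ** X = A ** Y" .
  have "X ** A = transpose (X ** A)" using X by simp
  also have "\<dots> = transpose ((X ** A) ** (Y ** A))" using Y by (metis matrix_mul_assoc)
  also have "\<dots> = (Y ** A) ** (X ** A)" using X Y by (simp only: matrix_transpose_mul)
  also have "\<dots> = Y ** A" using X by (metis matrix_mul_assoc)
  finally have r: "X ** A = Y ** A" .
  have "X = X ** A ** X" using X by simp
  also have "\<dots> = Y ** A ** Y" by (metis l r matrix_mul_assoc)
  finally show ?thesis using Y by simp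
qed

text \<open>The convention \<open>inverse 0 = 0\<close> makes \<open>t \<mapsto> inverse t\<close> satisfy the scalar Penrose equations at every
  real \<open>t\<close>, so applying it to the eigenvalues gives the pseudoinverse. The two properties stated are what
  makes the sketching matrices projectors.\<close>

lemma mp_pinv_symmetric:
  fixes G :: "real^'n^'n"
  assumes "transpose G = G"
  shows "transpose (mp_pinv G) = mp_pinv G" "mp_pinv G ** G ** mp_pinv G = mp_pinv G"
proof -
  obtain F :: "(real \<Rightarrow> real) \<Rightarrow> real^'n^'n" where F: "\<And>\<phi>. transpose (F \<phi>) = F \<phi>"
      "\<And>\<phi> \<psi>. F \<phi> ** F \<psi> = F (\<lambda>t. \<phi> t * \<psi> t)" "F (\<lambda>t. t) = G"
    using symmetric_functional_calculus[OF assms] by metis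
  have inv: "t * inverse t * t = t" "inverse t * t * inverse t = inverse t" for t :: real
    by (cases "t = 0"; simp)+
  have X: "is_mp_pinv G (F inverse)"
    unfolding is_mp_pinv_def F(3)[symmetric] F(2) inv by (simp add: F(1))
  have "mp_pinv G = F inverse"
    unfolding mp_pinv_def is_mp_pinv_def[symmetric]
    using X is_mp_pinv_unique[OF _ X] by (rule the_equality)
  then show "transpose (mp_pinv G) = mp_pinv G" "mp_pinv G ** G ** mp_pinv G = mp_pinv G"
    using F(1) X by (simp_all add: is_mp_pinv_def)
qed

section \<open>Sketching projectors and the error of a step\<close>

lemma matrix_inv_inverse:
  assumes "invertible M"
  shows "M ** matrix_inv M = mat 1" "matrix_inv M ** M = mat 1"
proof -
  have "M ** matrix_inv M = mat 1 \<and> matrix_inv M ** M = mat 1"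
    using assms unfolding invertible_def matrix_inv_def by (rule someI_ex)
  then show "M ** matrix_inv M = mat 1" "matrix_inv M ** M = mat 1" by auto
qed

lemma matrix_inv_eqI:
  fixes M N :: "real^'n^'n"
  assumes "M ** N = mat 1" shows "matrix_inv M = N"
proof -
  have "invertible M"
    using assms by (auto simp: invertible_right_inverse)
  then have "matrix_inv M ** (M ** N) = N"
    by (simp add: matrix_mul_assoc matrix_inv_inverse)
  then show ?thesis by (simp add: assms)
qed

lemma spd_sqrt:
  fixes B :: "real^'n^'n"
  assumes "spd_matrix B"
  defines "R \<equiv> matrix_sqrt B"
  shows "transpose R = R" "R ** R = B"
    and "R ** matrix_inv R = mat 1" "matrix_inv R ** R = mat 1"
    and "transpose (matrix_inv R) = matrix_inv R"
    and "matrix_inv B = matrix_inv R ** matrix_inv R"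
proof -
  have "psd_matrix B"
    using assms(1) unfolding spd_matrix_def psd_matrix_def
    by (metis inner_zero_left less_eq_real_def)
  from matrix_sqrt_psd[OF this] show sym: "transpose R = R" and sq: "R ** R = B"
    by (auto simp: R_def psd_matrix_def)
  have "R ** (R ** matrix_inv B) = mat 1"
    using matrix_inv_inverse(1)[OF invertible_spd_matrix[OF assms(1)]] by (simp add: matrix_mul_assoc sq)
  then have "invertible R"
    by (auto simp: invertible_right_inverse)
  then show r: "R ** matrix_inv R = mat 1" and l: "matrix_inv R ** R = mat 1"
    by (simp_all add: matrix_inv_inverse)
  have "R ** transpose (matrix_inv R) = transpose (matrix_inv R ** R)"
    by (simp add: matrix_transpose_mul sym)
  then show "transpose (matrix_inv R) = matrix_inv R"
    using matrix_inv_eqI[of R "transpose (matrix_inv R)"] by (simp add: l)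
  have "B ** (matrix_inv R ** matrix_inv R) = R ** (R ** matrix_inv R) ** matrix_inv R"
    by (simp only: sq[symmetric] matrix_mul_assoc)
  then show "matrix_inv B = matrix_inv R ** matrix_inv R"
    by (intro matrix_inv_eqI) (simp add: r)
qed

text \<open>With \<open>Q\<close> the inverse square root of \<open>B\<close> and \<open>L = Q A\<^sup>T T\<close> the matrix is
  \<open>L (L\<^sup>T L)\<^sup>\<dagger> L\<^sup>T\<close>, the orthogonal projector onto the range of \<open>L\<close>.\<close>

lemma sketch_Z_projector:
  fixes A :: "real^'n^'m" and T :: "real^'t^'m"
  assumes "spd_matrix B"
  shows "transpose (sketch_Z A B T) = sketch_Z A B T"
    and "sketch_Z A B T ** sketch_Z A B T = sketch_Z A B T"
proof -
  define Q where "Q = matrix_inv (matrix_sqrt B)"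
  have Q: "transpose Q = Q" "matrix_inv B = Q ** Q"
    using spd_sqrt[OF assms] by (simp_all add: Q_def)
  define L where "L = Q ** transpose A ** T"
  define P where "P = mp_pinv (transpose L ** L)"
  have "transpose (transpose L ** L) = transpose L ** L"
    by (simp add: matrix_transpose_mul)
  from mp_pinv_symmetric[OF this]
  have P: "transpose P = P" "P ** (transpose L ** L) ** P = P"
    by (simp_all add: P_def)
  have Lt: "transpose L = transpose T ** A ** Q"
    by (simp add: L_def matrix_transpose_mul Q matrix_mul_assoc)
  have Z: "sketch_Z A B T = L ** P ** transpose L"
    unfolding sketch_Z_def sketch_H_def P_def Lt
    by (simp add: L_def Q_def[symmetric] Q(2) matrix_mul_assoc)
  show "transpose (sketch_Z A B T) = sketch_Z A B T"
    by (simp add: Z matrix_transpose_mul P(1) matrix_mul_assoc)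
  have "sketch_Z A B T ** sketch_Z A B T = L ** (P ** (transpose L ** L) ** P) ** transpose L"
    by (simp add: Z matrix_mul_assoc)
  then show "sketch_Z A B T ** sketch_Z A B T = sketch_Z A B T"
    by (simp add: P(2) Z)
qed

lemma wnorm2_sqrt:
  assumes "spd_matrix B"
  shows "wnorm2 B v = (matrix_sqrt B *v v) \<bullet> (matrix_sqrt B *v v)"
  using inner_symmetric_matrix[OF spd_sqrt(1)[OF assms], of v "matrix_sqrt B *v v"]
  by (simp add: wnorm2_def matrix_vector_mul_assoc spd_sqrt(2)[OF assms])

lemma wnorm2_projector:
  assumes "transpose Z = Z" "Z ** Z = Z"
  shows "wnorm2 Z u = (Z *v u) \<bullet> (Z *v u)"
  using inner_symmetric_matrix[OF assms(1), of u "Z *v u"]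
  by (simp add: wnorm2_def matrix_vector_mul_assoc assms(2))

lemma matrix_inv_sqrt_sqrt:
  assumes "spd_matrix B"
  shows "matrix_inv (matrix_sqrt B) *v (matrix_sqrt B *v v) = v"
  by (simp add: matrix_vector_mul_assoc spd_sqrt(4)[OF assms])

text \<open>In the coordinates \<open>u = B^(1/2) (x - z)\<close>, where \<open>z\<close> is any solution, the sketched loss is the squared
  length of the projection of \<open>u\<close> onto the range of the projector \<open>Z\<close>. A step of the
  method removes exactly this projection (\<open>sketch_step_error\<close>).\<close>

lemma sketched_loss_eq_wnorm2:
  assumes B: "spd_matrix B" and z: "A *v z = b"
  shows "sketched_loss A b B T x = wnorm2 (sketch_Z A B T) (matrix_sqrt B *v (x - z))"
proof -
  define Q where "Q = matrix_inv (matrix_sqrt B)"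
  define u where "u = matrix_sqrt B *v (x - z)"
  have "A *v (Q *v u) = A *v x - b"
    using matrix_inv_sqrt_sqrt[OF B] z by (simp add: Q_def u_def matrix_vector_mult_diff_distrib)
  moreover have "sketch_Z A B T *v u = transpose (A ** Q) *v (sketch_H A B T *v (A *v (Q *v u)))"
    by (simp add: sketch_Z_def Q_def[symmetric] matrix_transpose_mul matrix_mul_assoc
        matrix_vector_mul_assoc spd_sqrt(5)[OF B, folded Q_def] del: transpose_matrix_vector)
  ultimately show ?thesis
    unfolding sketched_loss_def wnorm2_def u_def[symmetric]
    by (metis inner_matrix_vector_left matrix_vector_mul_assoc)
qed

lemma sketch_step_error:
  assumes B: "spd_matrix B" and z: "A *v z = b"
  shows "matrix_sqrt B *v (sketch_step A b B T x - z) =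
    matrix_sqrt B *v (x - z) - sketch_Z A B T *v (matrix_sqrt B *v (x - z))"
proof -
  define R where "R = matrix_sqrt B"
  define Q where "Q = matrix_inv R"
  note R = spd_sqrt[OF B, folded R_def, folded Q_def]
  define e where "e = x - z"
  have "sketch_Z A B T *v (R *v e) = (Q ** transpose A ** sketch_H A B T ** A ** (Q ** R)) *v e"
    by (simp add: sketch_Z_def R_def[symmetric] Q_def[symmetric] matrix_mul_assoc matrix_vector_mul_assoc)
  also have "\<dots> = ((R ** Q) ** Q ** transpose A ** sketch_H A B T ** A) *v e"
    by (simp only: R(3,4)) simp
  also have "\<dots> = R *v ((matrix_inv B ** transpose A ** sketch_H A B T) *v (A *v e))"
    by (simp add: R(6) matrix_mul_assoc matrix_vector_mul_assoc)
  also have "A *v e = A *v x - b"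
    by (simp add: e_def z matrix_vector_mult_diff_distrib)
  finally show ?thesis
    unfolding R_def[symmetric] sketch_step_def
    by (simp add: e_def matrix_vector_mult_diff_distrib)
qed

lemma wnorm2_sketch_step:
  assumes B: "spd_matrix B" and z: "A *v z = b"
  shows "wnorm2 B (sketch_step A b B T x - z) = wnorm2 B (x - z) - sketched_loss A b B T x"
proof -
  define u where "u = matrix_sqrt B *v (x - z)"
  define Z where "Z = sketch_Z A B T"
  have Z: "transpose Z = Z" "Z ** Z = Z" by (simp_all add: Z_def sketch_Z_projector B)
  have "(u - Z *v u) \<bullet> (u - Z *v u) = u \<bullet> u - wnorm2 Z u"
    using wnorm2_projector[OF Z, of u]
    by (simp add: wnorm2_def inner_diff_left inner_diff_right inner_commute)
  then show ?thesis
    by (simp add: wnorm2_sqrt[OF B] sketch_step_error[OF B z] sketched_loss_eq_wnorm2[OF B z]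
        u_def Z_def)
qed

lemma sketched_loss_nonneg:
  assumes "spd_matrix B" "A *v z = b"
  shows "0 \<le> sketched_loss A b B T x"
  by (simp add: sketched_loss_eq_wnorm2[OF assms] wnorm2_projector sketch_Z_projector[OF assms(1)])

lemma wnorm2_spd_nonneg:
  assumes "spd_matrix B" shows "0 \<le> wnorm2 B v"
  by (simp add: wnorm2_sqrt[OF assms])

lemma sketched_loss_le:
  assumes "spd_matrix B" "A *v z = b"
  shows "sketched_loss A b B T x \<le> wnorm2 B (x - z)"
  using wnorm2_sketch_step[OF assms, of T x] wnorm2_spd_nonneg[OF assms(1), of "sketch_step A b B T x - z"]
  by simp

text \<open>After a step the error is orthogonal to the range of the projector just applied. This is the reason
  for the improved rate: drawing the same sketch twice in a row gains nothing.\<close>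

lemma sketched_loss_sketch_step:
  assumes B: "spd_matrix B" and z: "A *v z = b"
  shows "sketched_loss A b B T (sketch_step A b B T x) = 0"
proof -
  define u where "u = matrix_sqrt B *v (x - z)"
  define Z where "Z = sketch_Z A B T"
  have "Z *v (u - Z *v u) = 0"
    by (simp add: Z_def matrix_vector_mult_diff_distrib matrix_vector_mul_assoc sketch_Z_projector(2)[OF B])
  then show ?thesis
    by (simp add: sketched_loss_eq_wnorm2[OF B z] sketch_step_error[OF B z] wnorm2_def u_def Z_def)
qed

lemma subspace_sketch_range: "subspace (sketch_range A B)"
  unfolding sketch_range_def by (intro linear_subspace_image) auto

lemma sketch_step_in_sketch_range:
  assumes "x \<in> sketch_range A B"
  shows "sketch_step A b B T x \<in> sketch_range A B"
proof -
  have "(matrix_inv B ** transpose A ** sketch_H A B T) *v (A *v x - b) \<in> sketch_range A B"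
    unfolding sketch_range_def by (rule image_eqI[of _ _ "sketch_H A B T *v (A *v x - b)"])
      (simp_all add: matrix_vector_mul_assoc)
  then show ?thesis
    unfolding sketch_step_def by (rule subspace_diff[OF subspace_sketch_range assms])
qed

text \<open>Subtracting from \<open>B^(1/2) y\<close> its component orthogonal to the range of \<open>B^(-1/2) A\<^sup>T\<close> does not change
  the image under \<open>A B^(-1/2)\<close>, whose kernel is that orthogonal complement.\<close>

lemma solution_in_sketch_range:
  assumes B: "spd_matrix B" and "A *v y = b"
  obtains w where "w \<in> sketch_range A B" "A *v w = b"
proof -
  define R where "R = matrix_sqrt B"
  define Q where "Q = matrix_inv R"
  note R = spd_sqrt[OF B, folded R_def, folded Q_def]
  define U where "U = range ((*v) (Q ** transpose A))"
  have "subspace U"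
    unfolding U_def by (intro linear_subspace_image) auto
  then obtain u c where u: "u \<in> U" and c: "\<And>d. d \<in> U \<Longrightarrow> orthogonal c d" and yc: "R *v y = u + c"
    using orthogonal_subspace_decomp_exists[of U "R *v y"] by (metis span_eq_iff)
  obtain t where t: "u = (Q ** transpose A) *v t" using u by (auto simp: U_def)
  have "(A *v (Q *v c)) \<bullet> s = c \<bullet> ((Q ** transpose A) *v s)" for s
    using inner_matrix_vector_left[of "A ** Q" c s]
    by (simp add: matrix_transpose_mul R(5) matrix_vector_mul_assoc del: transpose_matrix_vector)
  then have "(A *v (Q *v c)) \<bullet> (A *v (Q *v c)) = 0"
    using c unfolding U_def orthogonal_def by auto
  then have "A *v (Q *v c) = 0" by simp
  moreover have "y = Q *v u + Q *v c"
    using matrix_inv_sqrt_sqrt[OF B, of y] yc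
    by (simp add: R_def[symmetric] Q_def[symmetric] matrix_vector_right_distrib)
  ultimately have "A *v (Q *v u) = b"
    using assms(2) by (simp add: matrix_vector_right_distrib)
  moreover have "Q *v u = (matrix_inv B ** transpose A) *v t"
    by (simp add: t R(6) matrix_mul_assoc matrix_vector_mul_assoc)
  ultimately show ?thesis
    using that unfolding sketch_range_def by blast
qed

text \<open>A solution \<open>w\<close> in the sketch range is \<open>B\<close>-orthogonal to the kernel of \<open>A\<close>, so by Pythagoras it is the
  unique minimiser. Hence the errors of the iterates stay in the subspace over which the spectral
  constants are defined.\<close>

lemma min_norm_solution:
  assumes B: "spd_matrix B" and "\<exists>y. A *v y = b"
  shows "A *v min_norm_solution A b B = b" "min_norm_solution A b B \<in> sketch_range A B"
proof -
  obtain w where w: "w \<in> sketch_range A B" "A *v w = b"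
    using assms solution_in_sketch_range[OF B] by metis
  obtain t where t: "w = (matrix_inv B ** transpose A) *v t"
    using w(1) by (auto simp: sketch_range_def)
  have symB: "transpose B = B" using B by (simp add: spd_matrix_def)
  have Bw: "B *v w = transpose A *v t"
    using matrix_inv_inverse(1)[OF invertible_spd_matrix[OF B]]
    by (simp add: t matrix_vector_mul_assoc matrix_mul_assoc del: transpose_matrix_vector)
  have pyth: "wnorm2 B y = wnorm2 B w + wnorm2 B (y - w)" if y: "A *v y = b" for y
  proof -
    have "(y - w) \<bullet> (B *v w) = (A *v (y - w)) \<bullet> t"
      unfolding Bw by (simp only: inner_matrix_vector_left)
    then have 0: "(y - w) \<bullet> (B *v w) = 0"
      by (simp add: matrix_vector_mult_diff_distrib y w(2))
    have "wnorm2 B y = wnorm2 B (w + (y - w))" by simp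
    also have "\<dots> = wnorm2 B w + wnorm2 B (y - w) + 2 * ((y - w) \<bullet> (B *v w))"
      using inner_symmetric_matrix[OF symB, of w "y - w"]
      unfolding wnorm2_def matrix_vector_right_distrib inner_add_left inner_add_right
      by (simp add: inner_commute)
    finally show ?thesis using 0 by simp
  qed
  have "min_norm_solution A b B = w"
    unfolding min_norm_solution_def
  proof (rule arg_minI[where x = w])
    show "A *v w = b" by (rule w(2))
    show "\<not> 1 / 2 * wnorm2 B y < 1 / 2 * wnorm2 B w" if "A *v y = b" for y
      using pyth[OF that] wnorm2_spd_nonneg[OF B, of "y - w"] by simp
    show "y = w" if "A *v y = b" "\<forall>v. A *v v = b \<longrightarrow> \<not> 1 / 2 * wnorm2 B v < 1 / 2 * wnorm2 B y" for y
    proof -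
      have "wnorm2 B (y - w) \<le> 0" using pyth[OF that(1)] that(2) w(2) by fastforce
      then show ?thesis
        using B unfolding spd_matrix_def wnorm2_def by (metis eq_iff_diff_eq_0 not_less)
    qed
  qed
  then show "A *v min_norm_solution A b B = b" "min_norm_solution A b B \<in> sketch_range A B"
    using w by auto
qed

section \<open>Spectral constants and capped sampling\<close>

lemma pmean_real: "pmean p y = (\<Sum>i\<in>UNIV. p $ i * y i)" for y :: "'q::finite \<Rightarrow> real"
  by (simp add: pmean_def)

lemma matrix_vector_mult_sum_left: "(\<Sum>i\<in>I. M i) *v v = (\<Sum>i\<in>I. M i *v v)"
  for M :: "'i \<Rightarrow> real^'n^'m"
  by (induction I rule: infinite_finite_induct) (simp_all add: matrix_vector_mult_add_rdistrib)

lemma wnorm2_pmean: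
  fixes G :: "'q::finite \<Rightarrow> real^'n^'n"
  shows "wnorm2 (pmean p G) v = pmean p (\<lambda>i. wnorm2 (G i) v)"
  by (simp add: wnorm2_def pmean_def matrix_vector_mult_sum_left scaleR_matrix_vector_assoc[symmetric] inner_sum_right)

lemma sigma_inf_sq_le_Max_loss:
  fixes A :: "real^'n^'m" and S :: "'q::finite \<Rightarrow> real^'t^'m"
  assumes "A \<noteq> 0" "spd_matrix B" "A *v z = b" "x - z \<in> sketch_range A B"
  shows "sigma_inf_sq A B S * wnorm2 B (x - z) \<le> (MAX i. sketched_loss A b B (S i) x)"
proof (cases "x - z = 0")
  case True
  have "0 \<le> sketched_loss A b B (S undefined) x"
    by (rule sketched_loss_nonneg[OF assms(2,3)])
  also have "\<dots> \<le> (MAX i. sketched_loss A b B (S i) x)"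
    by (intro Max_ge) auto
  finally show ?thesis by (simp add: True wnorm2_def)
next
  case False
  then have pos: "0 < wnorm2 B (x - z)"
    using assms(2) by (auto simp: spd_matrix_def wnorm2_def)
  have "sigma_inf_sq A B S \<le> (MAX i. sketched_loss A b B (S i) x / wnorm2 B (x - z))"
    using sigma_inf_sq_attained[OF assms(1,2), of S] False assms(4)
    unfolding sketched_loss_eq_wnorm2[OF assms(2,3)] by (metis DiffI singletonD)
  also have "\<dots> \<le> (MAX i. sketched_loss A b B (S i) x) / wnorm2 B (x - z)"
    using pos by (auto intro!: divide_right_mono Max_ge)
  finally show ?thesis using pos by (simp add: pos_le_divide_eq)
qed

lemma sigma_p_sq_le_mean_loss:
  fixes A :: "real^'n^'m" and S :: "'q::finite \<Rightarrow> real^'t^'m"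
  assumes "A \<noteq> 0" "spd_matrix B" "A *v z = b" "x - z \<in> sketch_range A B"
  shows "sigma_p_sq A B S p * wnorm2 B (x - z) \<le> pmean p (\<lambda>i. sketched_loss A b B (S i) x)"
proof (cases "x - z = 0")
  case True
  then show ?thesis
    by (simp add: sketched_loss_eq_wnorm2[OF assms(2,3)] wnorm2_def pmean_def)
next
  case False
  then have pos: "0 < wnorm2 B (x - z)"
    using assms(2) by (auto simp: spd_matrix_def wnorm2_def)
  have "sigma_p_sq A B S p \<le> pmean p (\<lambda>i. sketched_loss A b B (S i) x) / wnorm2 B (x - z)"
    using sigma_p_sq_attained[OF assms(1,2), where S = S and p = p] False assms(4)
    by (auto simp: sketched_loss_eq_wnorm2[OF assms(2,3)] wnorm2_pmean)
  then show ?thesis using pos by (simp add: pos_le_divide_eq)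
qed

lemma pmean_zero_entry_le:
  fixes y :: "'q::finite \<Rightarrow> real"
  assumes "\<And>j. 0 \<le> p $ j" "y i = 0" "\<And>j. y j \<le> m"
  shows "pmean p y \<le> (\<Sum>j\<in>UNIV - {i}. p $ j) * m"
proof -
  have "pmean p y = (\<Sum>j\<in>UNIV - {i}. p $ j * y j)"
    using assms(2) by (simp add: pmean_real sum.remove[of UNIV i])
  also have "\<dots> \<le> (\<Sum>j\<in>UNIV - {i}. p $ j * m)"
    using assms by (intro sum_mono mult_left_mono) auto
  finally show ?thesis by (simp add: sum_distrib_right)
qed

lemma capped_gamma:
  fixes p :: "real^'q"
  assumes q: "CARD('q) \<ge> 2" and p: "p \<in> prob_simplex" "\<forall>i. p $ i > 0"
  shows "capped_gamma p > 1" "(\<Sum>j\<in>UNIV - {i}. p $ j) \<le> 1 / capped_gamma p"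
proof -
  define s where "s i = (\<Sum>j\<in>UNIV - {i}. p $ j)" for i
  define m where "m = (MAX i. s i)"
  have gam: "capped_gamma p = 1 / m" by (simp add: capped_gamma_def m_def s_def)
  have "m \<in> range s" unfolding m_def by (intro Max_in) auto
  then obtain k where k: "m = s k" by auto
  have "m + p $ k = 1"
    using p(1) sum.remove[of UNIV k "\<lambda>j. p $ j"] by (simp add: k s_def prob_simplex_def)
  then have "m < 1" using p(2) by (metis less_add_same_cancel1)
  have "UNIV - {k} \<noteq> {}"
  proof
    assume "UNIV - {k} = {}"
    then have "(UNIV :: 'q set) = {k}" by auto
    then have "CARD('q) = card {k}" by (rule arg_cong)
    then show False using q by simp
  qed
  then have "0 < m" unfolding k s_def using p(2) by (intro sum_pos) auto
  then show "capped_gamma p > 1" using \<open>m < 1\<close> by (simp add: gam)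
  have "s i \<le> m" unfolding m_def by (intro Max_ge) auto
  then show "(\<Sum>j\<in>UNIV - {i}. p $ j) \<le> 1 / capped_gamma p"
    by (simp add: gam s_def)
qed

text \<open>Once one loss vanishes, the mean over \<open>p\<close> puts weight at most \<open>1 / \<gamma>\<close> on the other losses, so the
  largest loss is at least \<open>\<gamma>\<close> times the mean.\<close>

lemma gamma_mean_loss_le_Max_loss:
  fixes A :: "real^'n^'m" and S :: "'q::finite \<Rightarrow> real^'t^'m" and p :: "real^'q"
  assumes B: "spd_matrix B" and z: "A *v z = b"
    and q: "CARD('q) \<ge> 2" and p: "p \<in> prob_simplex" "\<forall>i. p $ i > 0"
    and zero: "sketched_loss A b B (S i) x = 0"
  shows "capped_gamma p * pmean p (\<lambda>j. sketched_loss A b B (S j) x)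
    \<le> (MAX j. sketched_loss A b B (S j) x)"
proof -
  define m where "m = (MAX j. sketched_loss A b B (S j) x)"
  have ge: "sketched_loss A b B (S j) x \<le> m" for j unfolding m_def by (intro Max_ge) auto
  have "0 \<le> m" using ge[of i] zero by simp
  note gam = capped_gamma[OF q p]
  have "pmean p (\<lambda>j. sketched_loss A b B (S j) x) \<le> (\<Sum>j\<in>UNIV - {i}. p $ j) * m"
    using p(2) zero ge by (intro pmean_zero_entry_le) (auto intro: less_imp_le)
  also have "\<dots> \<le> (1 / capped_gamma p) * m"
    using gam(2) \<open>0 \<le> m\<close> by (rule mult_right_mono)
  finally show ?thesis
    using gam(1) unfolding m_def[symmetric] by (simp add: pos_le_divide_eq mult.commute)
qed

text \<open>This controls the sign of the contraction factor of the later steps. If some sketch does not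
  solve the homogeneous system in one step from every start, then a nonzero point that it reaches has zero
  loss for that sketch and is a test vector showing \<open>\<sigma>\<^sub>p\<^sup>2 \<le> 1 / \<gamma>\<close>. Otherwise every projector is
  the identity on the relevant subspace, and all quotients defining the constants are 1.\<close>

lemma gamma_sigma_p_le_1_or_sigmas_eq_1:
  fixes A :: "real^'n^'m" and S :: "'q::finite \<Rightarrow> real^'t^'m" and p :: "real^'q"
  assumes A: "A \<noteq> 0" and B: "spd_matrix B"
    and q: "CARD('q) \<ge> 2" and p: "p \<in> prob_simplex" "\<forall>i. p $ i > 0"
  shows "capped_gamma p * sigma_p_sq A B S p \<le> 1 \<or>
    sigma_inf_sq A B S = 1 \<and> sigma_p_sq A B S p = 1"
proof -
  have z: "A *v 0 = 0" by simp
  note gam = capped_gamma[OF q p]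
  show ?thesis
  proof (cases "\<exists>i. \<exists>v\<in>sketch_range A B. sketched_loss A 0 B (S i) v \<noteq> wnorm2 B v")
    case True
    then obtain i v where v: "v \<in> sketch_range A B" "sketched_loss A 0 B (S i) v \<noteq> wnorm2 B v"
      by blast
    define w where "w = sketch_step A 0 B (S i) v"
    have w: "w - 0 \<in> sketch_range A B"
      using sketch_step_in_sketch_range[OF v(1)] by (simp add: w_def)
    have pos: "0 < wnorm2 B w"
      using wnorm2_sketch_step[OF B z, of "S i" v] sketched_loss_le[OF B z, of "S i" v] v(2)
      by (simp add: w_def)
    have "pmean p (\<lambda>j. sketched_loss A 0 B (S j) w) \<le> (\<Sum>j\<in>UNIV - {i}. p $ j) * wnorm2 B w"
      using p(2) sketched_loss_le[OF B z, of _ w] sketched_loss_sketch_step[OF B z, of "S i" v]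
      by (intro pmean_zero_entry_le) (auto intro: less_imp_le simp: w_def)
    also have "\<dots> \<le> (1 / capped_gamma p) * wnorm2 B w"
      using gam(2) pos by (intro mult_right_mono) auto
    finally have "sigma_p_sq A B S p * wnorm2 B w \<le> (1 / capped_gamma p) * wnorm2 B w"
      using sigma_p_sq_le_mean_loss[OF A B z w, of S p] by simp
    then show ?thesis
      using pos gam(1) by (simp add: pos_le_divide_eq mult.commute)
  next
    case False
    then have loss: "wnorm2 (sketch_Z A B (S i)) (matrix_sqrt B *v v) = wnorm2 B v"
      if "v \<in> sketch_range A B" for i v
      using that sketched_loss_eq_wnorm2[OF B z, of "S i" v] by auto
    have ne: "wnorm2 B v \<noteq> 0" if "v \<noteq> 0" for v
      using B that unfolding spd_matrix_def wnorm2_def by (metis less_irrefl)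
    have "sigma_inf_sq A B S = 1"
      using sigma_inf_sq_attained[OF A B, of S] by (auto simp: loss ne)
    moreover have "sigma_p_sq A B S p = 1"
    proof -
      have "pmean p (\<lambda>i. wnorm2 B v) = wnorm2 B v" for v
        using p(1) by (simp add: pmean_real prob_simplex_def flip: sum_distrib_right)
      then show ?thesis
        using sigma_p_sq_attained[OF A B, where S = S and p = p] by (auto simp: wnorm2_pmean loss ne)
    qed
    ultimately show ?thesis by blast
  qed
qed

text \<open>Every index that the sampling can return has a loss of at least the capping threshold, hence so has their mean.\<close>

lemma capped_mean_ge:
  fixes S :: "'q::finite \<Rightarrow> real^'t^'m"
  assumes p': "p' \<in> prob_simplex" and supp: "{i. p' $ i \<noteq> 0} \<subseteq> capped_set A b B S p \<theta> x"
  shows "\<theta> * (MAX j. sketched_loss A b B (S j) x) + (1 - \<theta>) * pmean p (\<lambda>j. sketched_loss A b B (S j) x)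
    \<le> pmean p' (\<lambda>j. sketched_loss A b B (S j) x)"
proof -
  define l where "l = \<theta> * (MAX j. sketched_loss A b B (S j) x)
      + (1 - \<theta>) * pmean p (\<lambda>j. sketched_loss A b B (S j) x)"
  have "p' $ i * l \<le> p' $ i * sketched_loss A b B (S i) x" for i
  proof (cases "p' $ i = 0")
    case False
    then have "l \<le> sketched_loss A b B (S i) x"
      using supp by (auto simp: capped_set_def l_def)
    then show ?thesis using p' by (intro mult_left_mono) (auto simp: prob_simplex_def)
  qed simp
  then have "(\<Sum>i\<in>UNIV. p' $ i * l) \<le> pmean p' (\<lambda>j. sketched_loss A b B (S j) x)"
    unfolding pmean_real by (intro sum_mono)
  then show ?thesis
    using p' unfolding l_def[symmetric] by (simp add: prob_simplex_def flip: sum_distrib_right)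
qed

section \<open>Random iterations with finitely many states\<close>

lemma (in prob_space) expectation_finite_range:
  fixes f :: "'b \<Rightarrow> real"
  assumes "finite (Y ` space M)" "\<And>y. {\<omega>\<in>space M. Y \<omega> = y} \<in> events"
  shows "expectation (\<lambda>\<omega>. f (Y \<omega>)) = (\<Sum>y\<in>Y ` space M. f y * \<P>(\<omega> in M. Y \<omega> = y))"
proof -
  have "expectation (\<lambda>\<omega>. f (Y \<omega>)) =
      expectation (\<lambda>\<omega>. \<Sum>y\<in>Y ` space M. f y * indicator {\<omega>\<in>space M. Y \<omega> = y} \<omega>)"
  proof (rule Bochner_Integration.integral_cong[OF refl])
    fix \<omega> assume w: "\<omega> \<in> space M"
    have "(\<Sum>y\<in>Y ` space M. f y * indicator {\<omega>\<in>space M. Y \<omega> = y} \<omega>) =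
        (\<Sum>y\<in>Y ` space M. if y = Y \<omega> then f y else 0)"
      using w by (intro sum.cong) (auto simp: indicator_def)
    then show "f (Y \<omega>) = (\<Sum>y\<in>Y ` space M. f y * indicator {\<omega>\<in>space M. Y \<omega> = y} \<omega>)"
      using w assms(1) by simp
  qed
  also have "\<dots> = (\<Sum>y\<in>Y ` space M. f y * \<P>(\<omega> in M. Y \<omega> = y))"
  proof -
    have "integrable M (indicator {\<omega>\<in>space M. Y \<omega> = y} :: _ \<Rightarrow> real)" for y
      using assms(2) by (intro integrable_real_indicator) (auto simp: emeasure_eq_measure)
    then show ?thesis
      using assms(2) by (subst Bochner_Integration.integral_sum) (auto simp: Int_absorb1)
  qed
  finally show ?thesis .
qed

text \<open>The law of total expectation for an index \<open>J\<close> drawn with probabilities depending on the state \<open>X\<close>.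
  States of probability zero, for which the conditional law is unconstrained, contribute nothing.\<close>

lemma (in prob_space) expectation_random_step:
  fixes f :: "'b \<Rightarrow> 'i::finite \<Rightarrow> real" and P :: "'b \<Rightarrow> 'i \<Rightarrow> real"
  assumes X: "finite (X ` space M)" "\<And>z. {\<omega>\<in>space M. X \<omega> = z} \<in> events"
    and J: "J \<in> measurable M (count_space UNIV)"
    and cond: "\<And>z i. \<P>(\<omega> in M. X \<omega> = z) \<noteq> 0 \<Longrightarrow> \<P>(\<omega> in M. J \<omega> = i \<bar> X \<omega> = z) = P z i"
  shows "expectation (\<lambda>\<omega>. f (X \<omega>) (J \<omega>)) = expectation (\<lambda>\<omega>. \<Sum>i\<in>UNIV. P (X \<omega>) i * f (X \<omega>) i)"
proof -
  define joint where "joint z i = \<P>(\<omega> in M. X \<omega> = z \<and> J \<omega> = i)" for z i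
  have Jev: "{\<omega>\<in>space M. J \<omega> = i} \<in> events" for i
    using measurable_sets[OF J, of "{i}"] by (simp add: vimage_def Int_def conj_commute)
  have ev: "{\<omega>\<in>space M. X \<omega> = z \<and> J \<omega> = i} \<in> events" for z i
    using sets.Int[OF X(2)[of z] Jev[of i]] by (simp add: Int_def conj_ac cong: conj_cong)
  have joint: "joint z i = \<P>(\<omega> in M. X \<omega> = z) * P z i" for z i
  proof (cases "\<P>(\<omega> in M. X \<omega> = z) = 0")
    case True
    have "joint z i \<le> \<P>(\<omega> in M. X \<omega> = z)"
      unfolding joint_def by (intro finite_measure_mono X(2)) auto
    then show ?thesis using True measure_nonneg[of M] by (simp add: joint_def order_antisym)
  next
    case False
    then show ?thesis
      using cond[OF False, of i] by (simp add: cond_prob_def joint_def conj_commute field_simps)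
  qed
  define Y where "Y \<omega> = (X \<omega>, J \<omega>)" for \<omega>
  have sub: "Y ` space M \<subseteq> X ` space M \<times> UNIV" by (auto simp: Y_def)
  have fin: "finite (Y ` space M)" using X(1) by (intro finite_subset[OF sub]) simp
  have Yev: "{\<omega>\<in>space M. Y \<omega> = y} \<in> events" for y
    using ev[of "fst y" "snd y"] by (cases y) (simp add: Y_def)
  have "expectation (\<lambda>\<omega>. f (X \<omega>) (J \<omega>)) = expectation (\<lambda>\<omega>. (\<lambda>(z, i). f z i) (Y \<omega>))"
    by (simp add: Y_def)
  also have "\<dots> = (\<Sum>y\<in>Y ` space M. (\<lambda>(z, i). f z i) y * \<P>(\<omega> in M. Y \<omega> = y))"
    by (rule expectation_finite_range[OF fin Yev])
  also have "\<dots> = (\<Sum>y\<in>X ` space M \<times> UNIV. (\<lambda>(z, i). f z i) y * \<P>(\<omega> in M. Y \<omega> = y))"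
  proof (rule sum.mono_neutral_left[OF _ sub])
    show "finite (X ` space M \<times> (UNIV :: 'i set))" using X(1) by simp
    have "{\<omega>\<in>space M. Y \<omega> = y} = {}" if "y \<notin> Y ` space M" for y using that by auto
    then show "\<forall>y\<in>X ` space M \<times> UNIV - Y ` space M. (\<lambda>(z, i). f z i) y * \<P>(\<omega> in M. Y \<omega> = y) = 0"
      by (metis DiffD2 measure_empty mult_zero_right)
  qed
  also have "\<dots> = (\<Sum>z\<in>X ` space M. \<Sum>i\<in>UNIV. f z i * joint z i)"
    by (auto simp: sum.cartesian_product Y_def joint_def intro!: sum.cong)
  also have "\<dots> = (\<Sum>z\<in>X ` space M. (\<Sum>i\<in>UNIV. P z i * f z i) * \<P>(\<omega> in M. X \<omega> = z))"
    by (simp add: joint sum_distrib_right mult_ac)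
  also have "\<dots> = expectation (\<lambda>\<omega>. \<Sum>i\<in>UNIV. P (X \<omega>) i * f (X \<omega>) i)"
    by (rule expectation_finite_range[OF X, symmetric])
  finally show ?thesis .
qed

lemma (in prob_space) integrable_finite_range:
  fixes f :: "'b \<Rightarrow> real"
  assumes "finite (Y ` space M)" "\<And>y. {\<omega>\<in>space M. Y \<omega> = y} \<in> events"
  shows "integrable M (\<lambda>\<omega>. f (Y \<omega>))"
proof -
  have "simple_function M Y"
    using assms by (auto simp: simple_function_def vimage_def Int_def conj_commute)
  then have sf: "simple_function M (\<lambda>\<omega>. f (Y \<omega>))" by (rule simple_function_compose1)
  show ?thesis
  proof (rule integrable_const_bound[where B = "Max ((\<lambda>\<omega>. \<bar>f (Y \<omega>)\<bar>) ` space M)"])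
    have "finite ((\<lambda>\<omega>. \<bar>f (Y \<omega>)\<bar>) ` space M)"
      using assms(1) by (metis (no_types) finite_imageI image_image)
    then show "AE \<omega> in M. norm (f (Y \<omega>)) \<le> Max ((\<lambda>\<omega>. \<bar>f (Y \<omega>)\<bar>) ` space M)"
      by (auto intro!: AE_I2)
    show "(\<lambda>\<omega>. f (Y \<omega>)) \<in> borel_measurable M"
      using sf by (rule borel_measurable_simple_function)
  qed
qed

text \<open>A deterministic start and a finite set of updates leave only finitely many possible states at each
  time, so measurability of the drawn indices already makes all state events measurable.\<close>

lemma iterate_finite_events:
  fixes x :: "nat \<Rightarrow> 'w \<Rightarrow> 'b" and idx :: "nat \<Rightarrow> 'w \<Rightarrow> 'i::finite"
  assumes idx: "\<And>k. idx k \<in> measurable M (count_space UNIV)"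
    and start: "\<And>\<omega>. \<omega> \<in> space M \<Longrightarrow> x 0 \<omega> = x0"
    and step: "\<And>k \<omega>. \<omega> \<in> space M \<Longrightarrow> x (Suc k) \<omega> = h (idx k \<omega>) (x k \<omega>)"
  shows "finite (x k ` space M) \<and> (\<forall>z. {\<omega>\<in>space M. x k \<omega> = z} \<in> sets M)"
proof (induction k)
  case 0
  have "x 0 ` space M \<subseteq> {x0}" using start by auto
  moreover have "{\<omega>\<in>space M. x 0 \<omega> = z} = (if z = x0 then space M else {})" for z
    using start by auto
  ultimately show ?case by (auto intro: finite_subset)
next
  case (Suc k)
  have iev: "{\<omega>\<in>space M. idx k \<omega> = i} \<in> sets M" for i
    using measurable_sets[OF idx, of "{i}" k] by (simp add: vimage_def Int_def conj_commute)
  have "x (Suc k) ` space M \<subseteq> (\<lambda>(i, z). h i z) ` (UNIV \<times> x k ` space M)"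
    using step by force
  then have fin: "finite (x (Suc k) ` space M)"
    by (rule finite_subset) (use Suc in simp)
  have "{\<omega>\<in>space M. x (Suc k) \<omega> = z} =
      (\<Union>i. \<Union>y\<in>{y \<in> x k ` space M. h i y = z}.
         {\<omega>\<in>space M. idx k \<omega> = i} \<inter> {\<omega>\<in>space M. x k \<omega> = y})" for z
    using step by auto
  moreover have "(\<Union>i. \<Union>y\<in>{y \<in> x k ` space M. h i y = z}.
         {\<omega>\<in>space M. idx k \<omega> = i} \<inter> {\<omega>\<in>space M. x k \<omega> = y}) \<in> sets M" for z
    using Suc iev by (intro sets.finite_UN sets.Int) auto
  ultimately show ?case using fin by simp
qed

section \<open>Convergence of capped adaptive sketch-and-project\<close>

theorem theorem13:
  fixes A :: "real^'n^'m" and b :: "real^'m" and B :: "real^'n^'n"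
    and S :: "'q::finite \<Rightarrow> real^'t^'m"
    and p :: "real^'q" and \<theta> :: real and x0 :: "real^'n"
    and M :: "'w measure"
    and x :: "nat \<Rightarrow> 'w \<Rightarrow> real^'n"
    and idx :: "nat \<Rightarrow> 'w \<Rightarrow> 'q"
    and pk :: "nat \<Rightarrow> real^'n \<Rightarrow> real^'q"
  assumes A_nonzero: "A \<noteq> 0"
    and consistent: "\<exists>z. A *v z = b"
    and B_spd: "spd_matrix B"
    and q_ge_2: "CARD('q) \<ge> 2"
    and p_simplex: "p \<in> prob_simplex"
    and p_pos: "\<forall>i. p $ i > 0"
    and theta: "\<theta> \<in> {0..1}"
    and x0_range: "x0 \<in> sketch_range A B"
    and M_prob: "prob_space M"
    and idx_rv: "\<forall>k. idx k \<in> measurable M (count_space UNIV)"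
    and start: "\<forall>\<omega>\<in>space M. x 0 \<omega> = x0"
    and pk_simplex: "\<forall>k. \<forall>\<omega>\<in>space M. pk k (x k \<omega>) \<in> prob_simplex"
    and pk_support: "\<forall>k. \<forall>\<omega>\<in>space M.
          {i. pk k (x k \<omega>) $ i \<noteq> 0} \<subseteq> capped_set A b B S p \<theta> (x k \<omega>)"
    and draw: "\<forall>k z i. \<P>(\<omega> in M. x k \<omega> = z) \<noteq> 0 \<longrightarrow>
          \<P>(\<omega> in M. idx k \<omega> = i \<bar> x k \<omega> = z) = pk k z $ i"
    and step: "\<forall>k. \<forall>\<omega>\<in>space M.
          x (Suc k) \<omega> = sketch_step A b B (S (idx k \<omega>)) (x k \<omega>)"
  shows "capped_gamma p > 1 \<and>
    (\<forall>k\<ge>1.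
      prob_space.expectation M (\<lambda>\<omega>. wnorm2 B (x k \<omega> - min_norm_solution A b B))
      \<le> (1 - (\<theta> * capped_gamma p + (1 - \<theta>)) * sigma_p_sq A B S p) ^ (k - 1)
         * (1 - \<theta> * sigma_inf_sq A B S - (1 - \<theta>) * sigma_p_sq A B S p)
         * wnorm2 B (x0 - min_norm_solution A b B))"
proof -
  interpret prob_space M by (rule M_prob)
  define z where "z = min_norm_solution A b B"
  have z: "A *v z = b" "z \<in> sketch_range A B"
    using min_norm_solution[OF B_spd consistent] by (simp_all add: z_def)
  define f where "f i y = sketched_loss A b B (S i) y" for i y
  define g where "g = capped_gamma p"
  define s where "s = sigma_p_sq A B S p"
  define c where "c = 1 - (\<theta> * g + (1 - \<theta>)) * s"
  define d where "d = 1 - \<theta> * sigma_inf_sq A B S - (1 - \<theta>) * s"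
  define E where "E k = expectation (\<lambda>\<omega>. wnorm2 B (x k \<omega> - z))" for k
  have g1: "g > 1" unfolding g_def by (rule capped_gamma(1)[OF q_ge_2 p_simplex p_pos])
  have th: "0 \<le> \<theta>" "0 \<le> 1 - \<theta>" using theta by auto

  have fin: "finite (x k ` space M)" and ev: "{\<omega>\<in>space M. x k \<omega> = y} \<in> events" for k y
    using iterate_finite_events[of idx M x x0 "\<lambda>i. sketch_step A b B (S i)" k] idx_rv start step
    by auto
  have int: "integrable M (\<lambda>\<omega>. h (x k \<omega>))" for h :: "real^'n \<Rightarrow> real" and k
    by (rule integrable_finite_range[OF fin ev])

  have range: "x k \<omega> - z \<in> sketch_range A B" if "\<omega> \<in> space M" for k \<omega>
  proof -
    have "x k \<omega> \<in> sketch_range A B"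
      using that start step x0_range by (induction k) (auto intro: sketch_step_in_sketch_range)
    then show ?thesis using z(2) by (rule subspace_diff[OF subspace_sketch_range])
  qed

  \<comment> \<open>Given the iterate, a step lowers the squared error by the loss of the drawn sketch.\<close>
  have E_Suc: "E (Suc k) = expectation (\<lambda>\<omega>. wnorm2 B (x k \<omega> - z) - pmean (pk k (x k \<omega>)) (\<lambda>i. f i (x k \<omega>)))" for k
  proof -
    have "E (Suc k) = expectation (\<lambda>\<omega>. wnorm2 B (sketch_step A b B (S (idx k \<omega>)) (x k \<omega>) - z))"
      unfolding E_def using step by (intro Bochner_Integration.integral_cong) auto
    also have "\<dots> = expectation (\<lambda>\<omega>. \<Sum>i\<in>UNIV. pk k (x k \<omega>) $ i *
        wnorm2 B (sketch_step A b B (S i) (x k \<omega>) - z))"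
      using idx_rv draw by (intro expectation_random_step[OF fin ev]) auto
    also have "\<dots> = expectation (\<lambda>\<omega>. wnorm2 B (x k \<omega> - z) - pmean (pk k (x k \<omega>)) (\<lambda>i. f i (x k \<omega>)))"
    proof (rule Bochner_Integration.integral_cong[OF refl])
      fix \<omega> assume w: "\<omega> \<in> space M"
      then have "(\<Sum>i\<in>UNIV. pk k (x k \<omega>) $ i) = 1"
        using pk_simplex by (auto simp: prob_simplex_def)
      then show "(\<Sum>i\<in>UNIV. pk k (x k \<omega>) $ i * wnorm2 B (sketch_step A b B (S i) (x k \<omega>) - z)) =
          wnorm2 B (x k \<omega> - z) - pmean (pk k (x k \<omega>)) (\<lambda>i. f i (x k \<omega>))"
        by (simp add: wnorm2_sketch_step[OF B_spd z(1)] pmean_real f_def right_diff_distrib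
            sum_subtractf flip: sum_distrib_right)
    qed
    finally show ?thesis .
  qed
  have mean_loss: "\<theta> * (MAX i. f i (x k \<omega>)) + (1 - \<theta>) * pmean p (\<lambda>i. f i (x k \<omega>))
      \<le> pmean (pk k (x k \<omega>)) (\<lambda>i. f i (x k \<omega>))" if "\<omega> \<in> space M" for k \<omega>
    using capped_mean_ge[of "pk k (x k \<omega>)" A b B S p \<theta> "x k \<omega>"] pk_simplex pk_support that
    unfolding f_def by blast
  have contract: "E (Suc k) \<le> a * E k"
    if decr: "\<And>\<omega>. \<omega> \<in> space M \<Longrightarrow> (1 - a) * wnorm2 B (x k \<omega> - z) \<le> pmean (pk k (x k \<omega>)) (\<lambda>i. f i (x k \<omega>))"
    for a k
  proof -
    have "E (Suc k) \<le> expectation (\<lambda>\<omega>. a * wnorm2 B (x k \<omega> - z))"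
      unfolding E_Suc
    proof (rule integral_mono)
      show "integrable M (\<lambda>\<omega>. wnorm2 B (x k \<omega> - z) - pmean (pk k (x k \<omega>)) (\<lambda>i. f i (x k \<omega>)))"
        by (rule int)
      show "integrable M (\<lambda>\<omega>. a * wnorm2 B (x k \<omega> - z))"
        by (rule int)
      show "wnorm2 B (x k \<omega> - z) - pmean (pk k (x k \<omega>)) (\<lambda>i. f i (x k \<omega>)) \<le> a * wnorm2 B (x k \<omega> - z)"
        if "\<omega> \<in> space M" for \<omega>
        using decr[OF that] by (simp add: left_diff_distrib)
    qed
    then show ?thesis by (simp add: E_def)
  qed
  have s_mean: "s * wnorm2 B (x k \<omega> - z) \<le> pmean p (\<lambda>i. f i (x k \<omega>))" if "\<omega> \<in> space M" for k \<omega>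
    unfolding s_def f_def by (rule sigma_p_sq_le_mean_loss[OF A_nonzero B_spd z(1) range[OF that]])

  have first: "E 1 \<le> d * E 0"
    unfolding One_nat_def
  proof (rule contract)
    fix \<omega> assume w: "\<omega> \<in> space M"
    have "sigma_inf_sq A B S * wnorm2 B (x 0 \<omega> - z) \<le> (MAX i. f i (x 0 \<omega>))"
      unfolding f_def by (rule sigma_inf_sq_le_Max_loss[OF A_nonzero B_spd z(1) range[OF w]])
    then have "\<theta> * (sigma_inf_sq A B S * wnorm2 B (x 0 \<omega> - z)) + (1 - \<theta>) * (s * wnorm2 B (x 0 \<omega> - z))
        \<le> \<theta> * (MAX i. f i (x 0 \<omega>)) + (1 - \<theta>) * pmean p (\<lambda>i. f i (x 0 \<omega>))"
      using th s_mean[OF w] by (intro add_mono mult_left_mono)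
    also note mean_loss[OF w]
    finally show "(1 - d) * wnorm2 B (x 0 \<omega> - z) \<le> pmean (pk 0 (x 0 \<omega>)) (\<lambda>i. f i (x 0 \<omega>))"
      by (simp add: d_def algebra_simps)
  qed
  \<comment> \<open>From the second step on, the sketch drawn last has zero loss, which gains the factor \<open>\<gamma>\<close>.\<close>
  have later: "E (Suc (Suc k)) \<le> c * E (Suc k)" for k
  proof (rule contract)
    fix \<omega> assume w: "\<omega> \<in> space M"
    let ?x = "x (Suc k) \<omega>"
    have "sketched_loss A b B (S (idx k \<omega>)) ?x = 0"
      using step w sketched_loss_sketch_step[OF B_spd z(1)] by simp
    then have "g * pmean p (\<lambda>i. f i ?x) \<le> (MAX i. f i ?x)"
      unfolding f_def g_def by (rule gamma_mean_loss_le_Max_loss[OF B_spd z(1) q_ge_2 p_simplex p_pos])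
    moreover have "g * (s * wnorm2 B (?x - z)) \<le> g * pmean p (\<lambda>i. f i ?x)"
      using g1 s_mean[OF w] by (intro mult_left_mono) auto
    ultimately have "g * (s * wnorm2 B (?x - z)) \<le> (MAX i. f i ?x)" by simp
    then have "\<theta> * (g * (s * wnorm2 B (?x - z))) + (1 - \<theta>) * (s * wnorm2 B (?x - z))
        \<le> \<theta> * (MAX i. f i ?x) + (1 - \<theta>) * pmean p (\<lambda>i. f i ?x)"
      using th s_mean[OF w] by (intro add_mono mult_left_mono)
    also note mean_loss[OF w]
    finally show "(1 - c) * wnorm2 B (?x - z) \<le> pmean (pk (Suc k) ?x) (\<lambda>i. f i ?x)"
      by (simp add: c_def algebra_simps)
  qed
  have E0: "E 0 = wnorm2 B (x0 - z)"
  proof -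
    have "E 0 = expectation (\<lambda>_. wnorm2 B (x0 - z))"
      unfolding E_def using start by (intro Bochner_Integration.integral_cong) auto
    then show ?thesis by (simp add: prob_space)
  qed
  have E_nonneg: "0 \<le> E k" for k
    unfolding E_def by (intro Bochner_Integration.integral_nonneg wnorm2_spd_nonneg[OF B_spd])

  \<comment> \<open>The one-step bounds multiply only if \<open>c \<ge> 0\<close>. If \<open>c < 0\<close>, the first step already reaches \<open>z\<close>.\<close>
  have main: "E (Suc k) \<le> c ^ k * d * E 0" for k
    using gamma_sigma_p_le_1_or_sigmas_eq_1[OF A_nonzero B_spd q_ge_2 p_simplex p_pos, of S]
  proof
    assume gs: "capped_gamma p * sigma_p_sq A B S p \<le> 1"
    have "0 \<le> c"
    proof (cases "0 \<le> s")
      case True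
      have "s \<le> g * s" using True g1 by (simp add: mult_le_cancel_right1)
      then have "\<theta> * (g * s) + (1 - \<theta>) * s \<le> \<theta> * 1 + (1 - \<theta>) * 1"
        using gs th by (intro add_mono mult_left_mono) (auto simp: g_def s_def)
      then show ?thesis by (simp add: c_def algebra_simps)
    next
      case False
      have "0 \<le> \<theta> * g + (1 - \<theta>)" using th g1 by simp
      then have "(\<theta> * g + (1 - \<theta>)) * s \<le> 0" using False by (simp add: mult_nonneg_nonpos)
      then show ?thesis by (simp add: c_def)
    qed
    then show ?thesis
    proof (induction k)
      case (Suc k)
      have "E (Suc (Suc k)) \<le> c * E (Suc k)" by (rule later)
      also have "\<dots> \<le> c * (c ^ k * d * E 0)" using Suc by (intro mult_left_mono) auto
      finally show ?case by (simp add: mult_ac)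
    qed (use first in simp)
  next
    assume "sigma_inf_sq A B S = 1 \<and> sigma_p_sq A B S p = 1"
    then have d0: "d = 0" by (simp add: d_def s_def)
    have "E (Suc k) \<le> 0" for k
    proof (induction k)
      case (Suc k)
      have "E (Suc (Suc k)) \<le> c * E (Suc k)" by (rule later)
      also have "E (Suc k) = 0" using Suc E_nonneg by (simp add: order_antisym)
      finally show ?case by simp
    qed (use first d0 in simp)
    then show ?thesis by (simp add: d0)
  qed
  have "E k \<le> c ^ (k - 1) * d * wnorm2 B (x0 - z)" if "k \<ge> 1" for k
    using main[of "k - 1"] that by (simp add: E0)
  then show ?thesis
    using g1 unfolding E_def c_def d_def g_def s_def z_def by blast
qed

end
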